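(* Let $n \geq 3$ and let $S$ be a number. Then $S=\det(A)$ for some $A \in W_n$ if and only if $S$ is an integer that satisfies $$3-F_{n-1} \leq S \leq 3+F_{n-1}.$$
   Context: The Fibonacci numbers are $F_1=F_2=1$ and $F_k=F_{k-1}+F_{k-2}$ for $k\ge 3$. $W_n$ denotes the family of $n\times n$ matrices $A=(A_{ij})$ such that $A_{ij}=1$ if $j>i$, $A_{ij}=2$ if $j=i$, and $A_{ij}\in\{1,2\}$ (arbitrary) if $j<i$. *)

theory Defs
  imports "Jordan_Normal_Form.Determinant" "HOL-Number_Theory.Fib"
begin

text \<open>Rows and columns of a \<open>mat\<close> are numbered from \<open>0\<close> to \<open>n - 1\<close>; the conditions depend only on
  the order of the two indices, so the shift is immaterial.\<close>

definition W :: "nat \<Rightarrow> real mat set" where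
  "W n = {A \<in> carrier_mat n n. \<forall>i<n. \<forall>j<n.
            (j > i \<longrightarrow> A $$ (i, j) = 1) \<and>
            (j = i \<longrightarrow> A $$ (i, j) = 2) \<and>
            (j < i \<longrightarrow> A $$ (i, j) \<in> {1, 2})}"

end

theory Submission imports Defs begin

text \<open>Write \<open>A = J + B\<close> with \<open>J\<close> the all-ones matrix and \<open>B\<close> unit lower triangular with entries in
  \<open>{0, 1}\<close>. If \<open>B x = (1, \<dots>, 1)\<close> then \<open>det A = 1 + \<Sum>i. x i\<close>, and forward substitution says that
  each \<open>x i\<close> is \<open>1\<close> minus an arbitrary subset sum of the earlier entries. If \<open>P\<close> and \<open>N\<close> are the sums
  of the positive and negative parts of the first \<open>k\<close> entries, these subset sums fill the integer interval
  \<open>[-N, P]\<close>, so the next entry is any integer in \<open>[1 - P, 1 + N]\<close>, and the determinants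
  of size \<open>k + 1\<close> extending a given \<open>x\<close> are exactly the integers in \<open>[2 - N, 2 + P]\<close>. Induction on \<open>k\<close> gives
  \<open>P \<le> F k + 1\<close>, \<open>N \<le> F k - 1\<close> and \<open>P + N \<le> F (k + 1)\<close>; taking alternately the largest and
  the smallest admissible entry shows that each of the first two bounds is attained.\<close>

section \<open>The determinant by a triangular factorization\<close>

lemma det_W_eq:
  fixes x :: "nat \<Rightarrow> real"
  assumes A: "A \<in> W n" and "n > 0"
    and x: "\<And>i. i < n \<Longrightarrow> x i = 1 - (\<Sum>j<i. (A $$ (i, j) - 1) * x j)"
  shows "det A = 1 + (\<Sum>i<n. x i)"
proof -
  define s where "s = 1 + (\<Sum>i<n. x i)"
  \<comment> \<open>\<open>T\<close> replaces column 0 of the identity by \<open>x\<close>, so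
    \<open>A * T\<close> is \<open>A\<close> with column 0 replaced by \<open>A x\<close>, which is
    constantly \<open>s\<close>. \<open>L * U\<close> rebuilds this: column 0 is \<open>s\<close>
    times the all-ones column, and a later column is that all-ones column plus a column of
    \<open>A - J\<close>. As \<open>x 0 = 1\<close>, both \<open>T\<close> and \<open>L\<close> are
    unit triangular, and \<open>s\<close> is the only diagonal entry of \<open>U\<close> that may
    differ from 1.\<close>
  define T where "T = mat n n (\<lambda>(i, j). if j = 0 then x i else if i = j then 1 else 0)"
  define L where "L = mat n n (\<lambda>(i, j). if j = 0 then 1 else A $$ (i, j) - 1)"
  define U where "U = mat n n (\<lambda>(i, j). if j = 0 then (if i = 0 then s else 0)
                                        else if i = 0 \<or> i = j then 1 else 0)"
  have A_carrier: "A \<in> carrier_mat n n"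
    and A_upper: "\<And>i j. i < j \<Longrightarrow> j < n \<Longrightarrow> A $$ (i, j) = 1"
    and A_diag: "\<And>i. i < n \<Longrightarrow> A $$ (i, i) = 2"
    using A by (auto simp: W_def)
  have carrier [simp]: "T \<in> carrier_mat n n" "L \<in> carrier_mat n n" "U \<in> carrier_mat n n"
    by (auto simp: T_def L_def U_def)
  have x0: "x 0 = 1" using x[of 0] \<open>n > 0\<close> by simp
  have row: "(\<Sum>j<n. A $$ (i, j) * x j) = s" if "i < n" for i
  proof -
    \<comment> \<open>This is row \<open>i\<close> of \<open>B x = (1, ..., 1)\<close>: terms above
      the diagonal vanish and the diagonal coefficient is 1. Adding \<open>J x\<close> then gives
      \<open>s\<close>.\<close>
    have "(\<Sum>j<n. (A $$ (i, j) - 1) * x j) = (\<Sum>j<Suc i. (A $$ (i, j) - 1) * x j)"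
      using that by (intro sum.mono_neutral_right) (auto simp: A_upper)
    also have "\<dots> = 1" using x[OF that] A_diag[OF that] by simp
    finally show ?thesis by (simp add: s_def algebra_simps sum.distrib sum_subtractf)
  qed
  have "A * T = L * U"
  proof (rule eq_matI)
    fix i j assume "i < dim_row (L * U)" "j < dim_col (L * U)"
    then have ij: "i < n" "j < n" by (auto simp: L_def U_def)
    have AT: "(A * T) $$ (i, j) = (\<Sum>k<n. A $$ (i, k) * T $$ (k, j))"
      using ij A_carrier by (simp add: scalar_prod_def T_def lessThan_atLeast0)
    have LU: "(L * U) $$ (i, j) = (\<Sum>k<n. L $$ (i, k) * U $$ (k, j))"
      using ij by (simp add: scalar_prod_def L_def U_def lessThan_atLeast0)
    show "(A * T) $$ (i, j) = (L * U) $$ (i, j)"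
    proof (cases "j = 0")
      case True
      have "(\<Sum>k<n. A $$ (i, k) * T $$ (k, j)) = s"
        using row[OF ij(1)] True ij by (simp add: T_def)
      moreover have "(\<Sum>k<n. L $$ (i, k) * U $$ (k, j)) = (\<Sum>k\<in>{0}. L $$ (i, k) * U $$ (k, j))"
        using ij True by (intro sum.mono_neutral_right) (auto simp: U_def)
      ultimately show ?thesis
        unfolding AT LU using ij True by (simp add: L_def U_def)
    next
      case False
      have "(\<Sum>k<n. A $$ (i, k) * T $$ (k, j)) = (\<Sum>k\<in>{j}. A $$ (i, k) * T $$ (k, j))"
        using ij False by (intro sum.mono_neutral_right) (auto simp: T_def)
      moreover have "(\<Sum>k<n. L $$ (i, k) * U $$ (k, j)) = (\<Sum>k\<in>{0, j}. L $$ (i, k) * U $$ (k, j))"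
        using ij False by (intro sum.mono_neutral_right) (auto simp: U_def)
      ultimately show ?thesis
        unfolding AT LU using ij False by (simp add: L_def U_def T_def)
    qed
  qed (use A_carrier in \<open>auto simp: T_def L_def U_def\<close>)
  then have "det A * det T = det L * det U"
    using det_mult[OF A_carrier carrier(1)] det_mult[OF carrier(2,3)] by simp
  moreover have "det T = 1"
  proof -
    have "diag_mat T = replicate n 1"
      by (rule nth_equalityI) (auto simp: diag_mat_def T_def x0)
    then show ?thesis
      by (subst det_lower_triangular[of n]) (auto simp: T_def)
  qed
  moreover have "det L = 1"
  proof -
    have "diag_mat L = replicate n 1"
      by (rule nth_equalityI) (auto simp: diag_mat_def L_def A_diag)
    then show ?thesis
      by (subst det_lower_triangular[of n]) (auto simp: L_def A_upper)
  qed
  moreover have "det U = s"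
  proof -
    have "diag_mat U = s # replicate (n - 1) 1"
      using \<open>n > 0\<close> by (intro nth_equalityI) (auto simp: diag_mat_def U_def nth_Cons')
    then show ?thesis
      by (subst det_upper_triangular[of _ n]) (auto simp: U_def upper_triangular_def)
  qed
  ultimately show ?thesis by (simp add: s_def)
qed

section \<open>Admissible sequences and their subset sums\<close>

definition pos_sum :: "(nat \<Rightarrow> int) \<Rightarrow> nat \<Rightarrow> int" where
  "pos_sum x k = (\<Sum>i<k. max 0 (x i))"

definition neg_sum :: "(nat \<Rightarrow> int) \<Rightarrow> nat \<Rightarrow> int" where
  "neg_sum x k = (\<Sum>i<k. max 0 (- x i))"

lemma pos_sum_simps [simp]:
  "pos_sum x 0 = 0" "pos_sum x (Suc k) = pos_sum x k + max 0 (x k)"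
  and neg_sum_simps [simp]:
  "neg_sum x 0 = 0" "neg_sum x (Suc k) = neg_sum x k + max 0 (- x k)"
  by (simp_all add: pos_sum_def neg_sum_def)

lemma pos_sum_nonneg: "0 \<le> pos_sum x k" and neg_sum_nonneg: "0 \<le> neg_sum x k"
  by (simp_all add: pos_sum_def neg_sum_def sum_nonneg)

lemma pos_sum_upd [simp]: "k \<le> m \<Longrightarrow> pos_sum (x(m := v)) k = pos_sum x k"
  and neg_sum_upd [simp]: "k \<le> m \<Longrightarrow> neg_sum (x(m := v)) k = neg_sum x k"
  by (auto simp: pos_sum_def neg_sum_def intro!: sum.cong)

lemma sum_eq_pos_sum_minus_neg_sum: "(\<Sum>i<k. x i) = pos_sum x k - neg_sum x k"
  by (induction k) auto

definition admissible :: "nat \<Rightarrow> (nat \<Rightarrow> int) \<Rightarrow> bool" where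
  "admissible n x \<longleftrightarrow> (\<forall>i<n. 1 - pos_sum x i \<le> x i \<and> x i \<le> 1 + neg_sum x i)"

lemma admissible_0 [simp]: "admissible 0 x"
  by (simp add: admissible_def)

lemma admissible_Suc:
  "admissible (Suc n) x \<longleftrightarrow>
     admissible n x \<and> 1 - pos_sum x n \<le> x n \<and> x n \<le> 1 + neg_sum x n"
  by (auto simp: admissible_def less_Suc_eq)

lemma admissible_upd [simp]: "admissible n (x(n := v)) \<longleftrightarrow> admissible n x"
  by (simp add: admissible_def)

lemma subset_sum_bounds:
  assumes "K \<subseteq> {..<k}"
  shows "- neg_sum x k \<le> (\<Sum>j\<in>K. x j)" and "(\<Sum>j\<in>K. x j) \<le> pos_sum x k"
proof -
  have fin: "finite K" using assms finite_subset by blast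
  have "(\<Sum>j\<in>K. - x j) \<le> (\<Sum>j\<in>K. max 0 (- x j))" by (intro sum_mono) auto
  also have "\<dots> \<le> neg_sum x k"
    unfolding neg_sum_def using assms by (intro sum_mono2) auto
  finally show "- neg_sum x k \<le> (\<Sum>j\<in>K. x j)" by (simp add: sum_negf)
  have "(\<Sum>j\<in>K. x j) \<le> (\<Sum>j\<in>K. max 0 (x j))" by (intro sum_mono) auto
  also have "\<dots> \<le> pos_sum x k"
    unfolding pos_sum_def using assms by (intro sum_mono2) auto
  finally show "(\<Sum>j\<in>K. x j) \<le> pos_sum x k" .
qed

text \<open>The interval grows without gaps: admissibility of \<open>x k\<close> keeps the translate
  of [-N, P] by \<open>x k\<close> overlapping or adjacent to [-N, P]. A value outside the old
  interval therefore falls into it once \<open>x k\<close> is subtracted.\<close>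

lemma ex_subset_sum:
  assumes "admissible k x" "- neg_sum x k \<le> v" "v \<le> pos_sum x k"
  shows "\<exists>K \<subseteq> {..<k}. (\<Sum>j\<in>K. x j) = v"
  using assms
proof (induction k arbitrary: v)
  case 0
  then show ?case by auto
next
  case (Suc k)
  have adm: "admissible k x" "1 - pos_sum x k \<le> x k" "x k \<le> 1 + neg_sum x k"
    using Suc.prems(1) by (auto simp: admissible_Suc)
  have nonneg: "0 \<le> pos_sum x k" "0 \<le> neg_sum x k"
    by (simp_all add: pos_sum_nonneg neg_sum_nonneg)
  show ?case
  proof (cases "- neg_sum x k \<le> v \<and> v \<le> pos_sum x k")
    case True
    then obtain K where "K \<subseteq> {..<k}" "(\<Sum>j\<in>K. x j) = v" using Suc.IH adm by blast
    then show ?thesis by (intro exI[of _ K]) auto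
  next
    case False
    then have "- neg_sum x k \<le> v - x k" "v - x k \<le> pos_sum x k"
      using Suc.prems adm nonneg by (auto simp: max_def split: if_splits)
    then obtain K where K: "K \<subseteq> {..<k}" "(\<Sum>j\<in>K. x j) = v - x k" using Suc.IH adm by blast
    then have "finite K" "k \<notin> K" using finite_subset by auto
    then have "(\<Sum>j\<in>insert k K. x j) = v" using K by simp
    then show ?thesis using K by (intro exI[of _ "insert k K"]) auto
  qed
qed

text \<open>The map s -> 1 - s sends [-N, P] onto [1 - P, 1 + N]. The induction supplies the
  admissible prefix that makes every integer of [-N, P] a subset sum.\<close>

lemma admissible_iff_subset_sums:
  "admissible n x \<longleftrightarrow> (\<forall>i<n. \<exists>K \<subseteq> {..<i}. x i = 1 - (\<Sum>j\<in>K. x j))" (is "_ \<longleftrightarrow> ?R n")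
proof (induction n)
  case (Suc n)
  have "1 - pos_sum x n \<le> x n \<and> x n \<le> 1 + neg_sum x n \<longleftrightarrow>
          (\<exists>K \<subseteq> {..<n}. x n = 1 - (\<Sum>j\<in>K. x j))" if adm: "admissible n x"
  proof
    assume "1 - pos_sum x n \<le> x n \<and> x n \<le> 1 + neg_sum x n"
    then have "- neg_sum x n \<le> 1 - x n" "1 - x n \<le> pos_sum x n" by linarith+
    then obtain K where "K \<subseteq> {..<n}" "(\<Sum>j\<in>K. x j) = 1 - x n"
      using ex_subset_sum[OF adm] by blast
    then show "\<exists>K \<subseteq> {..<n}. x n = 1 - (\<Sum>j\<in>K. x j)" by (intro exI[of _ K]) simp
  next
    assume "\<exists>K \<subseteq> {..<n}. x n = 1 - (\<Sum>j\<in>K. x j)"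
    then obtain K where "K \<subseteq> {..<n}" "x n = 1 - (\<Sum>j\<in>K. x j)" by blast
    then show "1 - pos_sum x n \<le> x n \<and> x n \<le> 1 + neg_sum x n"
      using subset_sum_bounds[of K n x] by linarith
  qed
  then show ?case unfolding admissible_Suc All_less_Suc using Suc.IH by blast
qed simp

section \<open>Matrices versus admissible sequences\<close>

fun forward_subst :: "(nat \<Rightarrow> nat set) \<Rightarrow> nat \<Rightarrow> int" where
  "forward_subst K i = 1 - (\<Sum>j\<in>K i \<inter> {..<i}. forward_subst K j)"

declare forward_subst.simps [simp del]

lemma det_W_iff_admissible:
  assumes "n > 0"
  shows "(\<exists>A \<in> W n. S = det A) \<longleftrightarrow>
         (\<exists>x. admissible n x \<and> S = of_int (1 + (\<Sum>i<n. x i)))"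
proof
  assume "\<exists>A \<in> W n. S = det A"
  then obtain A where A: "A \<in> W n" and S: "S = det A" by blast
  \<comment> \<open>\<open>K i\<close> also contains the diagonal index \<open>i\<close>, and
    nothing is known about indices outside the matrix; intersecting with \<open>{..<i}\<close> in
    \<open>forward_subst\<close> discards these and makes the recursion well-founded.\<close>
  define K where "K i = {j. A $$ (i, j) = 2}" for i
  define x where "x = forward_subst K"
  have x: "x i = 1 - (\<Sum>j\<in>K i \<inter> {..<i}. x j)" for i
    unfolding x_def by (rule forward_subst.simps)
  have "admissible n x"
    unfolding admissible_iff_subset_sums using x by (metis Int_lower2)
  moreover have "det A = 1 + (\<Sum>i<n. real_of_int (x i))"
  proof (rule det_W_eq[OF A assms])
    fix i assume i: "i < n"
    have "(\<Sum>j<i. (A $$ (i, j) - 1) * real_of_int (x j)) =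
          (\<Sum>j\<in>K i \<inter> {..<i}. (A $$ (i, j) - 1) * real_of_int (x j))"
    proof (rule sum.mono_neutral_right)
      have "A $$ (i, j) \<in> {1, 2}" if "j < i" for j
        using A i that by (auto simp: W_def)
      then show "\<forall>j\<in>{..<i} - K i \<inter> {..<i}. (A $$ (i, j) - 1) * real_of_int (x j) = 0"
        by (fastforce simp: K_def)
    qed auto
    also have "\<dots> = (\<Sum>j\<in>K i \<inter> {..<i}. real_of_int (x j))"
      by (intro sum.cong) (auto simp: K_def)
    finally show "real_of_int (x i) = 1 - (\<Sum>j<i. (A $$ (i, j) - 1) * real_of_int (x j))"
      by (subst x) simp
  qed
  ultimately show "\<exists>x. admissible n x \<and> S = of_int (1 + (\<Sum>i<n. x i))"
    using S by auto
next
  assume "\<exists>x. admissible n x \<and> S = of_int (1 + (\<Sum>i<n. x i))"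
  then obtain x where adm: "admissible n x" and S: "S = of_int (1 + (\<Sum>i<n. x i))" by blast
  obtain K where K: "\<And>i. i < n \<Longrightarrow> K i \<subseteq> {..<i} \<and> x i = 1 - (\<Sum>j\<in>K i. x j)"
    using adm unfolding admissible_iff_subset_sums by metis
  define A :: "real mat" where
    "A = mat n n (\<lambda>(i, j). if j = i \<or> j < i \<and> j \<in> K i then 2 else 1)"
  have A: "A \<in> W n" by (auto simp: W_def A_def)
  have "det A = 1 + (\<Sum>i<n. real_of_int (x i))"
  proof (rule det_W_eq[OF A assms])
    fix i assume i: "i < n"
    have "(\<Sum>j<i. (A $$ (i, j) - 1) * real_of_int (x j)) =
          (\<Sum>j\<in>K i. (A $$ (i, j) - 1) * real_of_int (x j))"
      using K[OF i] i by (intro sum.mono_neutral_right) (auto simp: A_def)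
    also have "\<dots> = (\<Sum>j\<in>K i. real_of_int (x j))"
      using K[OF i] i by (intro sum.cong) (auto simp: A_def)
    finally show "real_of_int (x i) = 1 - (\<Sum>j<i. (A $$ (i, j) - 1) * real_of_int (x j))"
      using K[OF i] by simp
  qed
  then show "\<exists>A \<in> W n. S = det A" unfolding S using A by (intro bexI[of _ A]) auto
qed

section \<open>Fibonacci bounds and extremal sequences\<close>

lemma admissible_bounds:
  assumes "admissible (Suc k) x"
  shows "pos_sum x (Suc k) \<le> int (fib (Suc k)) + 1 \<and>
         neg_sum x (Suc k) \<le> int (fib (Suc k)) - 1 \<and>
         pos_sum x (Suc k) + neg_sum x (Suc k) \<le> int (fib (Suc (Suc k)))"
  using assms
proof (induction k)
  case 0
  then show ?case by (auto simp: admissible_Suc)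
next
  case (Suc k)
  define P N a where "P = pos_sum x (Suc k)" "N = neg_sum x (Suc k)" "a = x (Suc k)"
  have a: "1 - P \<le> a" "a \<le> 1 + N"
    using Suc.prems admissible_Suc[of "Suc k" x] by (simp_all only: P_N_a_def)
  have IH: "P \<le> int (fib (Suc k)) + 1" "N \<le> int (fib (Suc k)) - 1"
    "P + N \<le> int (fib (Suc (Suc k)))"
    using Suc admissible_Suc[of "Suc k" x] by (simp_all only: P_N_a_def)
  have nonneg: "0 \<le> P" "0 \<le> N" by (simp_all only: P_N_a_def pos_sum_nonneg neg_sum_nonneg)
  have mono: "int (fib (Suc k)) \<le> int (fib (Suc (Suc k)))" by simp
  have "fib (Suc (Suc (Suc k))) = fib (Suc (Suc k)) + fib (Suc k)" by simp
  then have rec: "int (fib (Suc (Suc (Suc k)))) = int (fib (Suc (Suc k))) + int (fib (Suc k))"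
    by linarith
  \<comment> \<open>A positive \<open>a\<close> adds at most \<open>1 + N\<close> to
    \<open>P\<close>, a negative one at most \<open>P - 1\<close> to \<open>N\<close>. The bound on
    \<open>P + N\<close> thus yields the new bounds on the sum that changes, and the old bounds on
    \<open>N\<close> and \<open>P\<close> yield the new bound on the total; \<open>mono\<close>
    covers the unchanged sum.\<close>
  show ?case
    unfolding rec pos_sum_simps(2)[of x "Suc k"] neg_sum_simps(2)[of x "Suc k"]
      P_N_a_def[symmetric]
    using a IH nonneg mono by (auto simp only: max_def split: if_splits)
qed

text \<open>The disjunction is the invariant of the alternation: the extremal sum determines the
  next entry, of absolute value \<open>fib (Suc k)\<close>, and this makes the opposite sum
  extremal.\<close>

lemma ex_extremal:
  "\<exists>x. admissible (Suc k) x \<and>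
       pos_sum x (Suc k) + neg_sum x (Suc k) = int (fib (Suc (Suc k))) \<and>
       (pos_sum x (Suc k) = int (fib (Suc k)) + 1 \<or> neg_sum x (Suc k) = int (fib (Suc k)) - 1)"
proof (induction k)
  case 0
  show ?case by (intro exI[of _ "\<lambda>_. 1"]) (auto simp: admissible_Suc)
next
  case (Suc k)
  then obtain x where x: "admissible (Suc k) x"
    and sum: "pos_sum x (Suc k) + neg_sum x (Suc k) = int (fib (Suc (Suc k)))"
    and extremal:
      "pos_sum x (Suc k) = int (fib (Suc k)) + 1 \<or> neg_sum x (Suc k) = int (fib (Suc k)) - 1"
    by blast
  define P N where "P = pos_sum x (Suc k)" "N = neg_sum x (Suc k)"
  define a where "a = (if P = int (fib (Suc k)) + 1 then 1 - P else 1 + N)"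
  define y where "y = x(Suc k := a)"
  have nonneg: "0 \<le> P" "0 \<le> N" by (simp_all only: P_N_def pos_sum_nonneg neg_sum_nonneg)
  have pos: "fib (Suc k) > 0" by (simp add: fib_neq_0_nat)
  have PN: "pos_sum y (Suc k) = P" "neg_sum y (Suc k) = N" "y (Suc k) = a"
    unfolding y_def P_N_def by (simp_all del: pos_sum_simps neg_sum_simps)
  have a: "1 - P \<le> a" "a \<le> 1 + N" using nonneg by (auto simp: a_def)
  have adm: "admissible (Suc (Suc k)) y"
    unfolding admissible_Suc[of "Suc k"] PN using x a by (simp add: y_def)
  have "fib (Suc (Suc (Suc k))) = fib (Suc (Suc k)) + fib (Suc k)" by simp
  then have rec: "int (fib (Suc (Suc (Suc k)))) = int (fib (Suc (Suc k))) + int (fib (Suc k))"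
    by linarith
  have goal: "P + max 0 a + (N + max 0 (- a)) = int (fib (Suc (Suc k))) + int (fib (Suc k)) \<and>
    (P + max 0 a = int (fib (Suc (Suc k))) + 1 \<or> N + max 0 (- a) = int (fib (Suc (Suc k))) - 1)"
    using sum extremal nonneg pos unfolding P_N_def[symmetric] a_def
    by (auto simp only: max_def split: if_splits)
  show ?case
    using adm goal unfolding PN[symmetric] rec[symmetric]
      pos_sum_simps(2)[symmetric] neg_sum_simps(2)[symmetric] by blast
qed

text \<open>Only the maximal total \<open>P + N\<close> of a prefix is needed: the last entry is
  free, so \<open>1 + N\<close> raises the positive sum to \<open>P + N + 1\<close> and
  \<open>1 - P\<close> raises the negative one to \<open>P + N - 1\<close>.\<close>

lemma ex_max_pos_sum:
  "\<exists>x. admissible (Suc (Suc k)) x \<and> pos_sum x (Suc (Suc k)) = int (fib (Suc (Suc k))) + 1"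
  and ex_max_neg_sum:
  "\<exists>x. admissible (Suc (Suc k)) x \<and> neg_sum x (Suc (Suc k)) = int (fib (Suc (Suc k))) - 1"
proof -
  obtain x where x: "admissible (Suc k) x"
    and sum: "pos_sum x (Suc k) + neg_sum x (Suc k) = int (fib (Suc (Suc k)))"
    using ex_extremal by blast
  define P N where "P = pos_sum x (Suc k)" "N = neg_sum x (Suc k)"
  have nonneg: "0 \<le> P" "0 \<le> N" by (simp_all only: P_N_def pos_sum_nonneg neg_sum_nonneg)
  have upd: "pos_sum (x(Suc k := a)) (Suc k) = P" "neg_sum (x(Suc k := a)) (Suc k) = N"
    "(x(Suc k := a)) (Suc k) = a" for a
    unfolding P_N_def by (simp_all del: pos_sum_simps neg_sum_simps)
  have adm: "admissible (Suc (Suc k)) (x(Suc k := a))" if "1 - P \<le> a" "a \<le> 1 + N" for a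
    unfolding admissible_Suc[of "Suc k"] upd using x that by simp
  have "pos_sum (x(Suc k := 1 + N)) (Suc (Suc k)) = int (fib (Suc (Suc k))) + 1"
    unfolding pos_sum_simps(2)[of _ "Suc k"] upd
    using nonneg sum unfolding P_N_def[symmetric] by linarith
  then show "\<exists>x. admissible (Suc (Suc k)) x \<and> pos_sum x (Suc (Suc k)) = int (fib (Suc (Suc k))) + 1"
    using adm[of "1 + N"] nonneg by force
  \<comment> \<open>Without this, \<open>1 - P\<close> could be positive and leave the negative sum
    unchanged. It follows from \<open>x k\<close> being at least 1 minus the positive sum before
    it.\<close>
  have "1 \<le> P"
    using x pos_sum_nonneg[of x k] by (cases k) (auto simp: P_N_def admissible_Suc)
  have "neg_sum (x(Suc k := 1 - P)) (Suc (Suc k)) = int (fib (Suc (Suc k))) - 1"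
    unfolding neg_sum_simps(2)[of _ "Suc k"] upd
    using nonneg sum \<open>1 \<le> P\<close> unfolding P_N_def[symmetric] by linarith
  then show "\<exists>x. admissible (Suc (Suc k)) x \<and> neg_sum x (Suc (Suc k)) = int (fib (Suc (Suc k))) - 1"
    using adm[of "1 - P"] nonneg by force
qed

section \<open>The range of attained sums\<close>

lemma admissible_sums_Suc:
  "(\<exists>x. admissible (Suc k) x \<and> v = (\<Sum>i<Suc k. x i)) \<longleftrightarrow>
   (\<exists>x. admissible k x \<and> 1 - neg_sum x k \<le> v \<and> v \<le> 1 + pos_sum x k)"
proof
  assume "\<exists>x. admissible (Suc k) x \<and> v = (\<Sum>i<Suc k. x i)"
  then show "\<exists>x. admissible k x \<and> 1 - neg_sum x k \<le> v \<and> v \<le> 1 + pos_sum x k"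
    by (auto simp: admissible_Suc sum_eq_pos_sum_minus_neg_sum)
next
  assume "\<exists>x. admissible k x \<and> 1 - neg_sum x k \<le> v \<and> v \<le> 1 + pos_sum x k"
  then obtain x where x: "admissible k x" "1 - neg_sum x k \<le> v" "v \<le> 1 + pos_sum x k" by blast
  \<comment> \<open>The last entry makes up the difference to \<open>v\<close>. Since the first
    \<open>k\<close> entries sum to P - N, it lies in [1 - P, 1 + N] exactly when \<open>v\<close>
    lies in [1 - N, 1 + P].\<close>
  define y where "y = x(k := v - (\<Sum>i<k. x i))"
  have "(\<Sum>i<k. y i) = (\<Sum>i<k. x i)" by (intro sum.cong) (auto simp: y_def)
  then have "v = (\<Sum>i<Suc k. y i)" by (simp add: y_def)
  moreover have "admissible (Suc k) y"
    using x unfolding admissible_Suc by (simp add: y_def sum_eq_pos_sum_minus_neg_sum)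
  ultimately show "\<exists>x. admissible (Suc k) x \<and> v = (\<Sum>i<Suc k. x i)" by blast
qed

lemma admissible_sums_fib:
  fixes v :: int
  shows "(\<exists>x. admissible (Suc (Suc (Suc k))) x \<and> v = (\<Sum>i<Suc (Suc (Suc k)). x i)) \<longleftrightarrow>
     2 - int (fib (Suc (Suc k))) \<le> v \<and> v \<le> 2 + int (fib (Suc (Suc k)))"
  unfolding admissible_sums_Suc
proof
  assume "\<exists>x. admissible (Suc (Suc k)) x \<and>
    1 - neg_sum x (Suc (Suc k)) \<le> v \<and> v \<le> 1 + pos_sum x (Suc (Suc k))"
  then show "2 - int (fib (Suc (Suc k))) \<le> v \<and> v \<le> 2 + int (fib (Suc (Suc k)))"
    using admissible_bounds[of "Suc k"] by force
next
  assume v: "2 - int (fib (Suc (Suc k))) \<le> v \<and> v \<le> 2 + int (fib (Suc (Suc k)))"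
  show "\<exists>x. admissible (Suc (Suc k)) x \<and>
    1 - neg_sum x (Suc (Suc k)) \<le> v \<and> v \<le> 1 + pos_sum x (Suc (Suc k))"
  \<comment> \<open>One sequence need not attain both extremes, but each interval [1 - N, 1 + P]
    contains 1, so the two extremal sequences together cover the whole range.\<close>
  proof (cases "1 \<le> v")
    case True
    obtain x where "admissible (Suc (Suc k)) x"
      "pos_sum x (Suc (Suc k)) = int (fib (Suc (Suc k))) + 1"
      using ex_max_pos_sum by blast
    then show ?thesis
      using v True neg_sum_nonneg[of x "Suc (Suc k)"] by (intro exI[of _ x]) linarith
  next
    case False
    obtain x where "admissible (Suc (Suc k)) x"
      "neg_sum x (Suc (Suc k)) = int (fib (Suc (Suc k))) - 1"
      using ex_max_neg_sum by blast
    then show ?thesis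
      using v False pos_sum_nonneg[of x "Suc (Suc k)"] by (intro exI[of _ x]) linarith
  qed
qed

theorem corollary4p2:
  fixes n :: nat and S :: real
  assumes "n \<ge> 3"
  shows "(\<exists>A \<in> W n. S = det A) \<longleftrightarrow>
         S \<in> \<int> \<and> 3 - real (fib (n - 1)) \<le> S \<and> S \<le> 3 + real (fib (n - 1))"
proof -
  obtain k where n: "n = Suc (Suc (Suc k))"
    using assms by (metis Suc_le_D numeral_3_eq_3 Suc_le_mono)
  \<comment> \<open>The determinant is 1 plus the entry sum, which moves the centre of the range
    from 2 to 3.\<close>
  have "(\<exists>A \<in> W n. S = det A) \<longleftrightarrow>
        (\<exists>v. (\<exists>x. admissible n x \<and> v = (\<Sum>i<n. x i)) \<and> S = of_int (1 + v))"
    using det_W_iff_admissible[of n S] assms by auto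
  also have "\<dots> \<longleftrightarrow> (\<exists>v. 2 - int (fib (n - 1)) \<le> v \<and> v \<le> 2 + int (fib (n - 1)) \<and> S = of_int (1 + v))"
    unfolding n admissible_sums_fib by simp
  also have "\<dots> \<longleftrightarrow> S \<in> \<int> \<and> 3 - real (fib (n - 1)) \<le> S \<and> S \<le> 3 + real (fib (n - 1))"
  proof
    assume "\<exists>v. 2 - int (fib (n - 1)) \<le> v \<and> v \<le> 2 + int (fib (n - 1)) \<and> S = of_int (1 + v)"
    then obtain v where "2 - int (fib (n - 1)) \<le> v" "v \<le> 2 + int (fib (n - 1))"
      and S: "S = of_int (1 + v)" by blast
    then show "S \<in> \<int> \<and> 3 - real (fib (n - 1)) \<le> S \<and> S \<le> 3 + real (fib (n - 1))"
      by (auto simp del: of_int_add)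
  next
    assume S: "S \<in> \<int> \<and> 3 - real (fib (n - 1)) \<le> S \<and> S \<le> 3 + real (fib (n - 1))"
    then obtain w where w: "S = of_int w" by (auto elim: Ints_cases)
    then show "\<exists>v. 2 - int (fib (n - 1)) \<le> v \<and> v \<le> 2 + int (fib (n - 1)) \<and> S = of_int (1 + v)"
      using S by (intro exI[of _ "w - 1"]) auto
  qed
  finally show ?thesis .
qed

end
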